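(* Let $\mathbb K$ be a field of characteristic $0$, let $(A,*,[\,,\,,])$ be a Lie-Yamaguti algebra over $\mathbb K$ and let $\beta$ be an endomorphism of $(A,*,[\,,\,,])$. Define on $A$ a binary operation $\tilde{*}$ and a ternary operation $\{\,,\,,\}$ by $$x\,\tilde{*}\,y:=\beta(x*y),\qquad \{x,y,z\}:=\beta^{2}([x,y,z])$$ for all $x,y,z\in A$. Then $(A,\tilde{*},\{\,,\,,\},\beta)$ is a Hom-Lie-Yamaguti algebra.
   Context: A Lie-Yamaguti algebra $(V,*,\{\,,\,,\})$ is a $\mathbb K$-vector space $V$ with a bilinear operation $*:V\times V\to V$ and a trilinear operation $\{\,,\,,\}:V\times V\times V\to V$ such that for all $u,v,w,x,y,z\in V$ (with $\sigma$ denoting the sum over cyclic permutations of $x,y,z$): (A1) $x*y=-y*x$; (A2) $\{x,y,z\}=-\{y,x,z\}$; (A3) $\sigma[(x*y)*z+\{x,y,z\}]=0$; (A4) $\sigma\{x*y,z,u\}=0$; (A5) $\{x,y,u*v\}=\{x,y,u\}*v+u*\{x,y,v\}$; (A6) $\{x,y,\{u,v,w\}\}=\{\{x,y,u\},v,w\}+\{u,\{x,y,v\},w\}+\{u,v,\{x,y,w\}\}$. In the claim the ternary operation of the given Lie-Yamaguti algebra is denoted $[\,,\,,]$. An endomorphism of $(A,*,[\,,\,,])$ is a linear map $\beta:A\to A$ with $\beta(x*y)=\beta(x)*\beta(y)$ and $\beta([x,y,z])=[\beta(x),\beta(y),\beta(z)]$ for all $x,y,z$. A Hom-Lie-Yamaguti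 algebra (Hom-LY algebra) is a quadruple $(L,*,\{\,,\,,\},\alpha)$ in which $L$ is a $\mathbb K$-vector space, $*$ is a bilinear binary operation on $L$, $\{\,,\,,\}$ is a trilinear ternary operation on $L$, and $\alpha:L\to L$ is a linear map, such that for all $u,v,w,x,y,z\in L$ (with $\sigma$ denoting the sum over cyclic permutations of $x,y,z$): (B1) $\alpha(x*y)=\alpha(x)*\alpha(y)$; (B2) $\alpha(\{x,y,z\})=\{\alpha(x),\alpha(y),\alpha(z)\}$; (B3) $x*y=-y*x$; (B4) $\{x,y,z\}=-\{y,x,z\}$; (B5) $\sigma[(x*y)*\alpha(z)+\{x,y,z\}]=0$; (B6) $\sigma[\{x*y,\alpha(z),\alpha(u)\}+\{z*y,\alpha(x),\alpha(u)\}]=0$; (B7) $\{\alpha(x),\alpha(y),u*v\}=\{x,y,u\}*\alpha^{2}(v)+\alpha^{2}(u)*\{x,y,v\}$; (B8) $\{\alpha^{2}(x),\alpha^{2}(y),\{\alpha^{2}(u),\alpha^{2}(v),w\}\}=\{\{x,y,\alpha^{2}(u)\},\alpha^{4}(v),\alpha^{2}(w)\}+\{\alpha^{4}(u),\{x,y,\alpha^{2}(v)\},\alpha^{2}(w)\}+\{\alpha^{4}(u),\alpha^{4}(v),\{x,y,w\}\}$. *)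

theory Defs
  imports Complex_Main
begin

definition bilinear_op ::
  "('k::field \<Rightarrow> 'a::ab_group_add \<Rightarrow> 'a) \<Rightarrow> ('a \<Rightarrow> 'a \<Rightarrow> 'a) \<Rightarrow> bool"
where
  "bilinear_op scale f \<longleftrightarrow>
     (\<forall>y. Vector_Spaces.linear scale scale (\<lambda>x. f x y)) \<and>
     (\<forall>x. Vector_Spaces.linear scale scale (\<lambda>y. f x y))"

definition trilinear_op ::
  "('k::field \<Rightarrow> 'a::ab_group_add \<Rightarrow> 'a) \<Rightarrow> ('a \<Rightarrow> 'a \<Rightarrow> 'a \<Rightarrow> 'a) \<Rightarrow> bool"
where
  "trilinear_op scale t \<longleftrightarrow>
     (\<forall>y z. Vector_Spaces.linear scale scale (\<lambda>x. t x y z)) \<and>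
     (\<forall>x z. Vector_Spaces.linear scale scale (\<lambda>y. t x y z)) \<and>
     (\<forall>x y. Vector_Spaces.linear scale scale (\<lambda>z. t x y z))"

definition cyclic_sum :: "('a \<Rightarrow> 'a \<Rightarrow> 'a \<Rightarrow> 'b::ab_group_add) \<Rightarrow> 'a \<Rightarrow> 'a \<Rightarrow> 'a \<Rightarrow> 'b"
where
  "cyclic_sum f x y z = f x y z + f y z x + f z x y"

(* In the axioms below the binders of the summand shadow the outer x, y, z; a further
   variable u is a parameter and is not permuted. *)
locale lie_yamaguti_algebra = vector_space scale
  for scale :: "'k::field \<Rightarrow> 'a::ab_group_add \<Rightarrow> 'a" +
  fixes star :: "'a \<Rightarrow> 'a \<Rightarrow> 'a"  (infixl "\<star>" 70)
    and ternary :: "'a \<Rightarrow> 'a \<Rightarrow> 'a \<Rightarrow> 'a"  ("\<lbrace>_,/ _,/ _\<rbrace>")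
  assumes bilinear: "bilinear_op scale (\<star>)"
    and trilinear: "trilinear_op scale ternary"
    and A1: "x \<star> y = - (y \<star> x)"
    and A2: "\<lbrace>x, y, z\<rbrace> = - \<lbrace>y, x, z\<rbrace>"
    and A3: "cyclic_sum (\<lambda>x y z. (x \<star> y) \<star> z + \<lbrace>x, y, z\<rbrace>) x y z = 0"
    and A4: "cyclic_sum (\<lambda>x y z. \<lbrace>x \<star> y, z, u\<rbrace>) x y z = 0"
    and A5: "\<lbrace>x, y, u \<star> v\<rbrace> = \<lbrace>x, y, u\<rbrace> \<star> v + u \<star> \<lbrace>x, y, v\<rbrace>"
    and A6: "\<lbrace>x, y, \<lbrace>u, v, w\<rbrace>\<rbrace> =
      \<lbrace>\<lbrace>x, y, u\<rbrace>, v, w\<rbrace> + \<lbrace>u, \<lbrace>x, y, v\<rbrace>, w\<rbrace> + \<lbrace>u, v, \<lbrace>x, y, w\<rbrace>\<rbrace>"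

locale lie_yamaguti_endomorphism = lie_yamaguti_algebra scale star ternary
  for scale :: "'k::field \<Rightarrow> 'a::ab_group_add \<Rightarrow> 'a"
    and star :: "'a \<Rightarrow> 'a \<Rightarrow> 'a"  (infixl "\<star>" 70)
    and ternary :: "'a \<Rightarrow> 'a \<Rightarrow> 'a \<Rightarrow> 'a"  ("\<lbrace>_,/ _,/ _\<rbrace>") +
  fixes \<beta> :: "'a \<Rightarrow> 'a"
  assumes linear: "Vector_Spaces.linear scale scale \<beta>"
    and hom_star: "\<beta> (x \<star> y) = \<beta> x \<star> \<beta> y"
    and hom_ternary: "\<beta> \<lbrace>x, y, z\<rbrace> = \<lbrace>\<beta> x, \<beta> y, \<beta> z\<rbrace>"

locale hom_lie_yamaguti_algebra = vector_space scale
  for scale :: "'k::field \<Rightarrow> 'a::ab_group_add \<Rightarrow> 'a" +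
  fixes star :: "'a \<Rightarrow> 'a \<Rightarrow> 'a"  (infixl "\<star>" 70)
    and ternary :: "'a \<Rightarrow> 'a \<Rightarrow> 'a \<Rightarrow> 'a"  ("\<lbrace>_,/ _,/ _\<rbrace>")
    and \<alpha> :: "'a \<Rightarrow> 'a"
  assumes bilinear: "bilinear_op scale (\<star>)"
    and trilinear: "trilinear_op scale ternary"
    and linear: "Vector_Spaces.linear scale scale \<alpha>"
    and B1: "\<alpha> (x \<star> y) = \<alpha> x \<star> \<alpha> y"
    and B2: "\<alpha> \<lbrace>x, y, z\<rbrace> = \<lbrace>\<alpha> x, \<alpha> y, \<alpha> z\<rbrace>"
    and B3: "x \<star> y = - (y \<star> x)"
    and B4: "\<lbrace>x, y, z\<rbrace> = - \<lbrace>y, x, z\<rbrace>"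
    and B5: "cyclic_sum (\<lambda>x y z. (x \<star> y) \<star> \<alpha> z + \<lbrace>x, y, z\<rbrace>) x y z = 0"
    and B6: "cyclic_sum (\<lambda>x y z. \<lbrace>x \<star> y, \<alpha> z, \<alpha> u\<rbrace> + \<lbrace>z \<star> y, \<alpha> x, \<alpha> u\<rbrace>) x y z = 0"
    and B7: "\<lbrace>\<alpha> x, \<alpha> y, u \<star> v\<rbrace> =
      \<lbrace>x, y, u\<rbrace> \<star> (\<alpha> ^^ 2) v + (\<alpha> ^^ 2) u \<star> \<lbrace>x, y, v\<rbrace>"
    and B8: "\<lbrace>(\<alpha> ^^ 2) x, (\<alpha> ^^ 2) y, \<lbrace>(\<alpha> ^^ 2) u, (\<alpha> ^^ 2) v, w\<rbrace>\<rbrace> =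
      \<lbrace>\<lbrace>x, y, (\<alpha> ^^ 2) u\<rbrace>, (\<alpha> ^^ 4) v, (\<alpha> ^^ 2) w\<rbrace> +
      \<lbrace>(\<alpha> ^^ 4) u, \<lbrace>x, y, (\<alpha> ^^ 2) v\<rbrace>, (\<alpha> ^^ 2) w\<rbrace> +
      \<lbrace>(\<alpha> ^^ 4) u, (\<alpha> ^^ 4) v, \<lbrace>x, y, w\<rbrace>\<rbrace>"

end

theory Submission
  imports Defs
begin

text \<open>
  An endomorphism \<open>\<beta>\<close> can be pushed through both operations until it sits on the variables only,
  so every monomial in the twisted operations \<open>\<beta> (x \<star> y)\<close> and \<open>\<beta>\<^sup>2 \<lbrace>x, y, z\<rbrace>\<close> equals the
  corresponding untwisted monomial evaluated at powers of \<open>\<beta>\<close> applied to the variables. The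
  powers of \<open>\<alpha>\<close> in the Hom axioms are placed exactly so that, with \<open>\<alpha> = \<beta>\<close>, each variable then
  carries the same power of \<open>\<beta>\<close> in all monomials of an axiom. Hence multiplicativity of the
  twisted operations is immediate, and the other Hom axioms are instances of the Lie-Yamaguti
  axioms at arguments of the form \<open>\<beta>\<^sup>k x\<close>, except that the one for \<open>\<lbrace>x \<star> y, z, u\<rbrace>\<close> is the sum
  of two such instances. Multilinearity of the twisted operations holds because composing with
  the linear maps \<open>\<beta>\<close> and \<open>\<beta>\<^sup>2\<close> preserves linearity in each argument.
\<close>

lemma bilinear_op_compose:
  assumes "Vector_Spaces.linear scale scale g" and "bilinear_op scale f"
  shows "bilinear_op scale (\<lambda>x y. g (f x y))"
  using assms Vector_Spaces.linear_compose[of scale scale _ scale g]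
  unfolding bilinear_op_def o_def by blast

lemma trilinear_op_compose:
  assumes "Vector_Spaces.linear scale scale g" and "trilinear_op scale t"
  shows "trilinear_op scale (\<lambda>x y z. g (t x y z))"
  using assms Vector_Spaces.linear_compose[of scale scale _ scale g]
  unfolding trilinear_op_def o_def by blast

context lie_yamaguti_endomorphism
begin

text \<open>
  Spelling out the second and fourth iterate lets the two homomorphism rules move every
  occurrence of \<open>\<beta>\<close> onto the variables; this is the normal form in which the twisted and the
  untwisted axioms can be compared.
\<close>

lemmas push_to_variables = numeral_eq_Suc hom_star hom_ternary

theorem twist_is_hom_lie_yamaguti:
  "hom_lie_yamaguti_algebra scale
     (\<lambda>x y. \<beta> (x \<star> y)) (\<lambda>x y z. (\<beta> ^^ 2) \<lbrace>x, y, z\<rbrace>) \<beta>"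
proof (intro hom_lie_yamaguti_algebra.intro hom_lie_yamaguti_algebra_axioms.intro)
  show "vector_space scale"
    by (rule vector_space_axioms)
  show "bilinear_op scale (\<lambda>x y. \<beta> (x \<star> y))"
    by (rule bilinear_op_compose[OF linear bilinear])
  have "Vector_Spaces.linear scale scale (\<beta> ^^ 2)"
    using Vector_Spaces.linear_compose[OF linear linear] by (simp add: numeral_eq_Suc)
  then show "trilinear_op scale (\<lambda>x y z. (\<beta> ^^ 2) \<lbrace>x, y, z\<rbrace>)"
    by (rule trilinear_op_compose[OF _ trilinear])
  show "Vector_Spaces.linear scale scale \<beta>"
    by (rule linear)
next
  fix x y z u v w
  show "\<beta> (\<beta> (x \<star> y)) = \<beta> (\<beta> x \<star> \<beta> y)"
    by (simp add: hom_star)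
  show "\<beta> ((\<beta> ^^ 2) \<lbrace>x, y, z\<rbrace>) = (\<beta> ^^ 2) \<lbrace>\<beta> x, \<beta> y, \<beta> z\<rbrace>"
    by (simp add: push_to_variables)
  show "\<beta> (x \<star> y) = - \<beta> (y \<star> x)"
    using A1[of "\<beta> x" "\<beta> y"] by (simp add: hom_star)
  show "(\<beta> ^^ 2) \<lbrace>x, y, z\<rbrace> = - (\<beta> ^^ 2) \<lbrace>y, x, z\<rbrace>"
    using A2[of "(\<beta> ^^ 2) x" "(\<beta> ^^ 2) y" "(\<beta> ^^ 2) z"] by (simp add: push_to_variables)
  show "cyclic_sum (\<lambda>x y z. \<beta> (\<beta> (x \<star> y) \<star> \<beta> z) + (\<beta> ^^ 2) \<lbrace>x, y, z\<rbrace>) x y z = 0"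
    using A3[of "(\<beta> ^^ 2) x" "(\<beta> ^^ 2) y" "(\<beta> ^^ 2) z"]
    by (simp add: cyclic_sum_def push_to_variables)
  (* Both halves of the summand give cyclic sums that vanish separately: the first is A4 for
     (x, y, z), and the second, up to a cyclic shift, is A4 for the reversed triple (z, y, x). *)
  show "cyclic_sum (\<lambda>x y z. (\<beta> ^^ 2) \<lbrace>\<beta> (x \<star> y), \<beta> z, \<beta> u\<rbrace>
      + (\<beta> ^^ 2) \<lbrace>\<beta> (z \<star> y), \<beta> x, \<beta> u\<rbrace>) x y z = 0"
  proof -
    let ?b = "\<beta> ^^ 3"
    have "\<lbrace>?b x \<star> ?b y, ?b z, ?b u\<rbrace> + \<lbrace>?b y \<star> ?b z, ?b x, ?b u\<rbrace>
        + \<lbrace>?b z \<star> ?b x, ?b y, ?b u\<rbrace> = 0"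
      using A4[of "?b u" "?b x" "?b y" "?b z"] by (simp add: cyclic_sum_def)
    moreover have "\<lbrace>?b z \<star> ?b y, ?b x, ?b u\<rbrace> + \<lbrace>?b x \<star> ?b z, ?b y, ?b u\<rbrace>
        + \<lbrace>?b y \<star> ?b x, ?b z, ?b u\<rbrace> = 0"
      using A4[of "?b u" "?b z" "?b y" "?b x"] by (simp add: cyclic_sum_def algebra_simps)
    ultimately have "(\<lbrace>?b x \<star> ?b y, ?b z, ?b u\<rbrace> + \<lbrace>?b y \<star> ?b z, ?b x, ?b u\<rbrace>
        + \<lbrace>?b z \<star> ?b x, ?b y, ?b u\<rbrace>) + (\<lbrace>?b z \<star> ?b y, ?b x, ?b u\<rbrace>
        + \<lbrace>?b x \<star> ?b z, ?b y, ?b u\<rbrace> + \<lbrace>?b y \<star> ?b x, ?b z, ?b u\<rbrace>) = 0"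
      by simp
    then show ?thesis
      by (simp add: cyclic_sum_def push_to_variables ac_simps)
  qed
  show "(\<beta> ^^ 2) \<lbrace>\<beta> x, \<beta> y, \<beta> (u \<star> v)\<rbrace> =
      \<beta> ((\<beta> ^^ 2) \<lbrace>x, y, u\<rbrace> \<star> (\<beta> ^^ 2) v) + \<beta> ((\<beta> ^^ 2) u \<star> (\<beta> ^^ 2) \<lbrace>x, y, v\<rbrace>)"
    using A5[of "(\<beta> ^^ 3) x" "(\<beta> ^^ 3) y" "(\<beta> ^^ 3) u" "(\<beta> ^^ 3) v"]
    by (simp add: push_to_variables)
  (* The exponents are those that the variables collect on the left: for x and y, 2 + 2; for w,
     2 + 2 from the two brackets; for u and v, 2 + 2 + 2. *)
  show "(\<beta> ^^ 2) \<lbrace>(\<beta> ^^ 2) x, (\<beta> ^^ 2) y, (\<beta> ^^ 2) \<lbrace>(\<beta> ^^ 2) u, (\<beta> ^^ 2) v, w\<rbrace>\<rbrace> =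
      (\<beta> ^^ 2) \<lbrace>(\<beta> ^^ 2) \<lbrace>x, y, (\<beta> ^^ 2) u\<rbrace>, (\<beta> ^^ 4) v, (\<beta> ^^ 2) w\<rbrace> +
      (\<beta> ^^ 2) \<lbrace>(\<beta> ^^ 4) u, (\<beta> ^^ 2) \<lbrace>x, y, (\<beta> ^^ 2) v\<rbrace>, (\<beta> ^^ 2) w\<rbrace> +
      (\<beta> ^^ 2) \<lbrace>(\<beta> ^^ 4) u, (\<beta> ^^ 4) v, (\<beta> ^^ 2) \<lbrace>x, y, w\<rbrace>\<rbrace>"
    using A6[of "(\<beta> ^^ 4) x" "(\<beta> ^^ 4) y" "(\<beta> ^^ 6) u" "(\<beta> ^^ 6) v" "(\<beta> ^^ 4) w"]
    by (simp add: push_to_variables)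
qed

end

theorem corollary3p2:
  fixes scale :: "'k::field_char_0 \<Rightarrow> 'a::ab_group_add \<Rightarrow> 'a"
    and star :: "'a \<Rightarrow> 'a \<Rightarrow> 'a"
    and bracket :: "'a \<Rightarrow> 'a \<Rightarrow> 'a \<Rightarrow> 'a"
    and \<beta> :: "'a \<Rightarrow> 'a"
  assumes "lie_yamaguti_algebra scale star bracket"
    and "lie_yamaguti_endomorphism scale star bracket \<beta>"
  shows "hom_lie_yamaguti_algebra scale
           (\<lambda>x y. \<beta> (star x y)) (\<lambda>x y z. (\<beta> ^^ 2) (bracket x y z)) \<beta>"
  using assms(2) by (rule lie_yamaguti_endomorphism.twist_is_hom_lie_yamaguti)

end
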